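(* Let $X$ be a complex Banach space and let $T$ be a closed linear operator with domain $D(T)\subset X$ and values in $X$, with nonempty resolvent set $\rho(T)$. Then $T$ has a purely B-discrete spectrum if and only if $T$ has a meromorphic resolvent.
   Context: For a closed linear operator $T:D(T)\subset X\to X$, write $N(T)$, $R(T)$ for its nullspace and range, $\sigma(T)$ and $\rho(T)$ for its spectrum and resolvent set. Ascent: $a(T)=\inf\{n\in\mathbb N: N(T^n)=N(T^{n+1})\}$; descent: $\delta(T)=\inf\{n\in\mathbb N: R(T^n)=R(T^{n+1})\}$ (with $\inf\emptyset=\infty$, $\mathbb N=\{0,1,2,\dots\}$, and $T^n$ defined on its natural domain). $T$ is Drazin invertible if $a(T)$ and $\delta(T)$ are both finite. The Drazin spectrum is $\sigma_{D}(T)=\{\lambda\in\mathbb C: T-\lambda I\text{ is not Drazin invertible}\}$. The B-discrete spectrum is $\sigma_{bd}(T)=\sigma(T)\setminus\sigma_D(T)$, and $T$ has a purely B-discrete spectrum if $\sigma(T)=\sigma_{bd}(T)$. A bounded linear operator $S$ on $X$ is meromorphic if $0$ is the only possible accumulation point of $\sigma(S)$ and every nonzero isolated point of $\sigma(S)$ is a pole of the resolvent $\mu\mapsto(S-\mu I)^{-1}$. A closed operator $T$ with nonempty resolvent set has a meromorphic resolvent if there is $\lambda\in\rho(T)$ such that $(T-\lambda I)^{-1}$ is a bounded meromorphic operator. *)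

theory Defs
  imports "HOL-Analysis.Analysis" "HOL-Library.Extended_Nat"
begin

class complex_normed_vector = real_normed_vector +
  fixes scaleC :: "complex \<Rightarrow> 'a \<Rightarrow> 'a"  (infixr \<open>*\<^sub>C\<close> 75)
  assumes scaleC_add_right: "a *\<^sub>C (x + y) = a *\<^sub>C x + a *\<^sub>C y"
    and scaleC_add_left: "(a + b) *\<^sub>C x = a *\<^sub>C x + b *\<^sub>C x"
    and scaleC_scaleC: "a *\<^sub>C b *\<^sub>C x = (a * b) *\<^sub>C x"
    and scaleC_one: "1 *\<^sub>C x = x"
    and scaleR_scaleC: "r *\<^sub>R x = complex_of_real r *\<^sub>C x"
    and norm_scaleC: "norm (a *\<^sub>C x) = cmod a * norm x"

class complex_banach = complex_normed_vector + banach

instantiation complex :: complex_banach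
begin

definition scaleC_complex :: "complex \<Rightarrow> complex \<Rightarrow> complex"
  where "scaleC_complex a x = a * x"

instance
  by standard
    (simp_all add: scaleC_complex_def scaleR_conv_of_real distrib_left distrib_right norm_mult)

end

definition bounded_clinear :: "('a::complex_normed_vector \<Rightarrow> 'a) \<Rightarrow> bool"
  where "bounded_clinear f \<longleftrightarrow> bounded_linear f \<and> (\<forall>c x. f (c *\<^sub>C x) = c *\<^sub>C f x)"

text \<open>An operator with domain \<open>D\<close> is given by \<open>D\<close> together with a total function \<open>T\<close>
  whose values outside \<open>D\<close> are irrelevant. An everywhere defined operator has domain
  \<open>UNIV\<close>.\<close>

definition linear_operator :: "'a::complex_normed_vector set \<Rightarrow> ('a \<Rightarrow> 'a) \<Rightarrow> bool"
  where "linear_operator D T \<longleftrightarrow>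
    0 \<in> D \<and> (\<forall>x\<in>D. \<forall>y\<in>D. x + y \<in> D \<and> T (x + y) = T x + T y) \<and>
    (\<forall>c. \<forall>x\<in>D. c *\<^sub>C x \<in> D \<and> T (c *\<^sub>C x) = c *\<^sub>C T x)"

definition closed_linear_operator :: "'a::complex_normed_vector set \<Rightarrow> ('a \<Rightarrow> 'a) \<Rightarrow> bool"
  where "closed_linear_operator D T \<longleftrightarrow>
    linear_operator D T \<and> closed {(x, T x) | x. x \<in> D}"

definition shift :: "('a::complex_normed_vector \<Rightarrow> 'a) \<Rightarrow> complex \<Rightarrow> 'a \<Rightarrow> 'a"
  where "shift T l x = T x - l *\<^sub>C x"

definition resolvent :: "'a::complex_normed_vector set \<Rightarrow> ('a \<Rightarrow> 'a) \<Rightarrow> complex \<Rightarrow> 'a \<Rightarrow> 'a"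
  where "resolvent D T l = inv_into D (shift T l)"

definition resolvent_set :: "'a::complex_normed_vector set \<Rightarrow> ('a \<Rightarrow> 'a) \<Rightarrow> complex set"
  where "resolvent_set D T =
    {l. bij_betw (shift T l) D UNIV \<and> bounded_clinear (resolvent D T l)}"

definition spectrum :: "'a::complex_normed_vector set \<Rightarrow> ('a \<Rightarrow> 'a) \<Rightarrow> complex set"
  where "spectrum D T = - resolvent_set D T"

text \<open>The natural domain of \<open>T\<^sup>n\<close>: all of \<open>T\<^sup>0 x, \<dots>, T\<^sup>n\<^sup>-\<^sup>1 x\<close> must lie in \<open>D\<close>. For \<open>n = 0\<close> it is
  the whole space.\<close>

definition power_domain :: "'a set \<Rightarrow> ('a \<Rightarrow> 'a) \<Rightarrow> nat \<Rightarrow> 'a set"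
  where "power_domain D T n = {x. \<forall>k<n. (T ^^ k) x \<in> D}"

definition nullspace_power :: "'a::zero set \<Rightarrow> ('a \<Rightarrow> 'a) \<Rightarrow> nat \<Rightarrow> 'a set"
  where "nullspace_power D T n = {x \<in> power_domain D T n. (T ^^ n) x = 0}"

definition range_power :: "'a set \<Rightarrow> ('a \<Rightarrow> 'a) \<Rightarrow> nat \<Rightarrow> 'a set"
  where "range_power D T n = (T ^^ n) ` power_domain D T n"

text \<open>In \<^typ>\<open>enat\<close> the infimum of the empty set is \<open>\<infinity>\<close>.\<close>

definition ascent :: "'a::zero set \<Rightarrow> ('a \<Rightarrow> 'a) \<Rightarrow> enat"
  where "ascent D T =
    Inf {enat n | n. nullspace_power D T n = nullspace_power D T (Suc n)}"

definition descent :: "'a set \<Rightarrow> ('a \<Rightarrow> 'a) \<Rightarrow> enat"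
  where "descent D T = Inf {enat n | n. range_power D T n = range_power D T (Suc n)}"

definition Drazin_invertible :: "'a::zero set \<Rightarrow> ('a \<Rightarrow> 'a) \<Rightarrow> bool"
  where "Drazin_invertible D T \<longleftrightarrow> ascent D T \<noteq> \<infinity> \<and> descent D T \<noteq> \<infinity>"

definition Drazin_spectrum :: "'a::complex_normed_vector set \<Rightarrow> ('a \<Rightarrow> 'a) \<Rightarrow> complex set"
  where "Drazin_spectrum D T = {l. \<not> Drazin_invertible D (shift T l)}"

definition B_discrete_spectrum :: "'a::complex_normed_vector set \<Rightarrow> ('a \<Rightarrow> 'a) \<Rightarrow> complex set"
  where "B_discrete_spectrum D T = spectrum D T - Drazin_spectrum D T"

definition purely_B_discrete_spectrum :: "'a::complex_normed_vector set \<Rightarrow> ('a \<Rightarrow> 'a) \<Rightarrow> bool"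
  where "purely_B_discrete_spectrum D T \<longleftrightarrow> spectrum D T = B_discrete_spectrum D T"

text \<open>\<open>z\<close> is a pole (of order \<open>n \<ge> 1\<close>) of the operator-valued function \<open>F\<close>: on some punctured
  disc around \<open>z\<close>, \<open>F\<close> is the sum, in operator norm, of a Laurent series
  \<open>\<Sum>k. (\<mu> - z)\<^sup>k\<^sup>-\<^sup>n A\<^sub>k\<close> with bounded coefficients and \<open>A\<^sub>0 \<noteq> 0\<close>. The library's \<open>is_pole\<close>, which asks
  that the norm tend to infinity, does not serve here: it does not exclude essential singularities
  of vector-valued functions, and the norm of a resolvent tends to infinity at every isolated
  point of the spectrum.\<close>

definition operator_pole ::
    "(complex \<Rightarrow> 'a::complex_normed_vector \<Rightarrow> 'a) \<Rightarrow> complex \<Rightarrow> bool"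
  where "operator_pole F z \<longleftrightarrow>
    (\<exists>n\<ge>1. \<exists>A :: nat \<Rightarrow> 'a \<Rightarrow> 'a. \<exists>r>0.
      (\<forall>k. bounded_clinear (A k)) \<and> A 0 \<noteq> (\<lambda>x. 0) \<and>
      (\<forall>\<mu>. 0 < dist \<mu> z \<and> dist \<mu> z < r \<longrightarrow>
        bounded_clinear (F \<mu>) \<and>
        (\<lambda>N. onorm (\<lambda>x. F \<mu> x - (\<Sum>k<N. ((\<mu> - z) powi (int k - int n)) *\<^sub>C A k x)))
          \<longlonglongrightarrow> 0))"

definition meromorphic_operator :: "('a::complex_normed_vector \<Rightarrow> 'a) \<Rightarrow> bool"
  where "meromorphic_operator S \<longleftrightarrow>
    bounded_clinear S \<and>
    (\<forall>z. z islimpt spectrum UNIV S \<longrightarrow> z = 0) \<and>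
    (\<forall>z. z \<noteq> 0 \<and> z isolated_in spectrum UNIV S \<longrightarrow> operator_pole (resolvent UNIV S) z)"

definition has_meromorphic_resolvent :: "'a::complex_normed_vector set \<Rightarrow> ('a \<Rightarrow> 'a) \<Rightarrow> bool"
  where "has_meromorphic_resolvent D T \<longleftrightarrow>
    (\<exists>l\<in>resolvent_set D T. meromorphic_operator (resolvent D T l))"

end

(* Let S = (T - l0)^-1. For l \<noteq> l0 and \<mu> = 1 / (l - l0), the powers of T - l and S - \<mu> have the
   same nullspaces and ranges, so it remains to show that a bounded operator S is meromorphic iff
   B = S - z is Drazin invertible for every nonzero z in its spectrum.
   If B has finite ascent and descent, the open mapping theorem yields a bounded projection P onto
   N(B^n) along R(B^n) and a bounded Drazin inverse G, and the Laurent series of (B - l)^-1 at 0 is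
   written down explicitly in terms of P and G.
   Conversely, comparing coefficients in (B - l) F(l) = I = F(l) (B - l), for
   F(l) = \<Sum>k. l^(k-n) A_k, gives B^n = B^(n+1) A_n = A_n B^(n+1). *)

theory Submission
  imports Defs
begin

subsection \<open>Bounded complex-linear maps\<close>

lemma bounded_linear_scaleC_right: "bounded_linear (\<lambda>x. a *\<^sub>C (x::'a::complex_normed_vector))"
proof (rule bounded_linear_intro[where K = "cmod a"])
  show "a *\<^sub>C (r *\<^sub>R x) = r *\<^sub>R (a *\<^sub>C x)" for r and x :: 'a
    by (simp add: scaleR_scaleC scaleC_scaleC mult.commute)
qed (simp_all add: scaleC_add_right norm_scaleC mult.commute)

lemma bounded_linear_scaleC_left: "bounded_linear (\<lambda>a. a *\<^sub>C (x::'a::complex_normed_vector))"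
proof (rule bounded_linear_intro[where K = "norm x"])
  show "(r *\<^sub>R a) *\<^sub>C x = r *\<^sub>R (a *\<^sub>C x)" for r and a :: complex
    by (metis scaleC_scaleC scaleR_conv_of_real scaleR_scaleC)
qed (simp_all add: scaleC_add_left norm_scaleC mult.commute)

lemmas scaleC_zero_right [simp] = linear_0[OF bounded_linear.linear[OF bounded_linear_scaleC_right]]
  and scaleC_minus_right [simp] = linear_neg[OF bounded_linear.linear[OF bounded_linear_scaleC_right]]
  and scaleC_diff_right = linear_diff[OF bounded_linear.linear[OF bounded_linear_scaleC_right]]
  and scaleC_zero_left [simp] = linear_0[OF bounded_linear.linear[OF bounded_linear_scaleC_left]]
  and scaleC_minus_left [simp] = linear_neg[OF bounded_linear.linear[OF bounded_linear_scaleC_left]]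
  and scaleC_diff_left = linear_diff[OF bounded_linear.linear[OF bounded_linear_scaleC_left]]

declare scaleC_one [simp]

lemma scaleC_eq_0_iff [simp]:
  "a *\<^sub>C (x::'a::complex_normed_vector) = 0 \<longleftrightarrow> a = 0 \<or> x = 0"
  by (metis mult_eq_0_iff norm_eq_zero norm_scaleC)

lemma bounded_clinearI:
  assumes "\<And>x y. f (x + y) = f x + f y" "\<And>c x. f (c *\<^sub>C x) = c *\<^sub>C f x" "\<And>x. norm (f x) \<le> K * norm x"
  shows "bounded_clinear f"
  unfolding bounded_clinear_def
proof
  show "bounded_linear f"
    by (rule bounded_linear_intro[where K = K])
      (auto simp: assms(1,2) scaleR_scaleC intro: order_trans[OF assms(3)])
qed (use assms(2) in blast)

lemma bounded_clinear_imp_linear: "bounded_clinear f \<Longrightarrow> bounded_linear f"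
  by (simp add: bounded_clinear_def)

lemmas clinear_zero = linear_0[OF bounded_linear.linear[OF bounded_clinear_imp_linear]]
  and clinear_add = linear_add[OF bounded_linear.linear[OF bounded_clinear_imp_linear]]
  and clinear_diff = linear_diff[OF bounded_linear.linear[OF bounded_clinear_imp_linear]]
  and clinear_minus = linear_neg[OF bounded_linear.linear[OF bounded_clinear_imp_linear]]

lemma clinear_scaleC: "bounded_clinear f \<Longrightarrow> f (c *\<^sub>C x) = c *\<^sub>C f x"
  by (simp add: bounded_clinear_def)

lemma clinear_bound: "bounded_clinear f \<Longrightarrow> \<exists>K>0. \<forall>x. norm (f x) \<le> K * norm x"
  by (metis bounded_clinear_def bounded_linear.pos_bounded mult.commute)

lemmas clinear_rules = clinear_zero clinear_add clinear_diff clinear_minus clinear_scaleC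

lemma bounded_clinear_zero: "bounded_clinear (\<lambda>x. 0)"
  by (rule bounded_clinearI[where K = 0]) auto

lemma bounded_clinear_id: "bounded_clinear (\<lambda>x. x)"
  by (rule bounded_clinearI[where K = 1]) auto

lemma bounded_clinear_comp:
  "bounded_clinear f \<Longrightarrow> bounded_clinear g \<Longrightarrow> bounded_clinear (\<lambda>x. f (g x))"
  by (simp add: bounded_clinear_def bounded_linear_compose)

lemma bounded_clinear_add:
  "bounded_clinear f \<Longrightarrow> bounded_clinear g \<Longrightarrow> bounded_clinear (\<lambda>x. f x + g x)"
  by (simp add: bounded_clinear_def bounded_linear_add scaleC_add_right)

lemma bounded_clinear_minus: "bounded_clinear f \<Longrightarrow> bounded_clinear (\<lambda>x. - f x)"
  by (simp add: bounded_clinear_def bounded_linear_minus)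

lemma bounded_clinear_diff:
  "bounded_clinear f \<Longrightarrow> bounded_clinear g \<Longrightarrow> bounded_clinear (\<lambda>x. f x - g x)"
  using bounded_clinear_add[of f "\<lambda>x. - g x"] by (simp add: bounded_clinear_minus)

lemma bounded_clinear_scaleC: "bounded_clinear f \<Longrightarrow> bounded_clinear (\<lambda>x. c *\<^sub>C f x)"
  by (simp add: bounded_clinear_def scaleC_scaleC mult.commute
      bounded_linear_compose[OF bounded_linear_scaleC_right])

lemma bounded_clinear_sum:
  "(\<And>i. i \<in> I \<Longrightarrow> bounded_clinear (f i)) \<Longrightarrow> bounded_clinear (\<lambda>x. \<Sum>i\<in>I. f i x)"
  by (induction I rule: infinite_finite_induct)
    (simp_all add: bounded_clinear_zero bounded_clinear_add)

lemma bounded_clinear_funpow: "bounded_clinear f \<Longrightarrow> bounded_clinear (f ^^ n)"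
proof (induction n)
  case 0
  then show ?case by (simp add: bounded_clinear_id id_def)
next
  case (Suc n)
  then show ?case by (simp add: comp_def bounded_clinear_comp)
qed

lemma bounded_clinear_shift: "bounded_clinear f \<Longrightarrow> bounded_clinear (shift f l)"
  unfolding shift_def[abs_def]
  by (intro bounded_clinear_diff bounded_clinear_scaleC bounded_clinear_id)

lemma norm_funpow_le:
  fixes f :: "'a::real_normed_vector \<Rightarrow> 'a"
  assumes "\<And>x. norm (f x) \<le> K * norm x" "K \<ge> 0"
  shows "norm ((f ^^ n) x) \<le> K ^ n * norm x"
proof (induction n)
  case (Suc n)
  have "norm ((f ^^ Suc n) x) \<le> K * norm ((f ^^ n) x)"
    using assms(1)[of "(f ^^ n) x"] by simp
  also have "\<dots> \<le> K * (K ^ n * norm x)"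
    using Suc assms(2) by (rule mult_left_mono)
  finally show ?case by (simp add: mult.assoc)
qed simp

subsection \<open>The open mapping theorem\<close>

lemma surj_bounded_linear_approx:
  fixes f :: "'c::real_normed_vector \<Rightarrow> 'b::banach"
  assumes f: "bounded_linear f" and K: "subspace K" and surj: "f ` K = UNIV"
  shows "\<exists>M\<ge>0. \<forall>y. \<exists>k\<in>K. norm k \<le> M * norm y \<and> norm (y - f k) \<le> norm y / 2"
proof -
  have lin: "linear f" using f by (rule bounded_linear.linear)
  note [simp] = linear_0[OF lin] and lins = linear_add[OF lin] linear_diff[OF lin] linear_scale[OF lin]
  define E where "E n = closure (f ` (K \<inter> cball 0 (real n)))" for n
  have UN: "(\<Union>n. E n) = UNIV"
  proof -
    have "y \<in> (\<Union>n. E n)" for y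
    proof -
      obtain k where k: "k \<in> K" "y = f k" using surj by auto
      obtain n where "norm k \<le> real n" using real_arch_simple by blast
      then have "y \<in> E n" unfolding E_def using k closure_subset by fastforce
      then show ?thesis by blast
    qed
    then show ?thesis by blast
  qed
  have "\<exists>n. interior (E n) \<noteq> {}"
  proof (rule ccontr)
    assume "\<not> ?thesis"
    then have "euclidean interior_of \<Union> (range E) = {}"
      by (intro Baire_category_alt) (auto simp: completely_metrizable_space_euclidean E_def)
    then show False using UN by simp
  qed
  then obtain n y0 where "y0 \<in> interior (E n)" by blast
  then obtain e where e: "e > 0" "ball y0 e \<subseteq> E n"
    by (meson mem_interior)
  have "\<exists>k\<in>K. norm k \<le> (4 * real n / e) * norm y \<and> norm (y - f k) \<le> norm y / 2" for y
  proof (cases "y = 0")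
    case True
    then show ?thesis using K by (intro bexI[of _ 0]) (auto simp: subspace_0)
  next
    case False
    define s where "s = e / (2 * norm y)"
    have s: "s > 0" using e False by (simp add: s_def)
    have "norm (s *\<^sub>R y) = e / 2" using e False by (simp add: s_def)
    then have in1: "y0 + s *\<^sub>R y \<in> E n" and in2: "y0 \<in> E n"
      using e by (auto simp: subset_iff dist_norm)
    have d: "e / 8 > 0" using e by simp
    obtain k1 where k1: "k1 \<in> K" "norm k1 \<le> n" "dist (f k1) (y0 + s *\<^sub>R y) < e / 8"
      using in1 d unfolding E_def closure_approachable by (fastforce simp del: less_divide_eq_numeral1)
    obtain k2 where k2: "k2 \<in> K" "norm k2 \<le> n" "dist (f k2) y0 < e / 8"
      using in2 d unfolding E_def closure_approachable by (fastforce simp del: less_divide_eq_numeral1)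
    define k where "k = (1 / s) *\<^sub>R (k1 - k2)"
    have "k \<in> K" unfolding k_def using K k1 k2 by (simp add: subspace_diff subspace_mul)
    moreover have "norm k \<le> (4 * real n / e) * norm y"
    proof -
      have "norm (k1 - k2) \<le> 2 * real n"
        using norm_triangle_ineq4[of k1 k2] k1(2) k2(2) by linarith
      then have "norm k \<le> (1 / s) * (2 * real n)"
        using s by (simp add: k_def divide_right_mono)
      also have "\<dots> = (4 * real n / e) * norm y"
        using e False by (simp add: s_def field_simps)
      finally show ?thesis .
    qed
    moreover have "norm (y - f k) \<le> norm y / 2"
    proof -
      have "y - f k = (1 / s) *\<^sub>R ((y0 + s *\<^sub>R y - f k1) - (y0 - f k2))"
        using s by (simp add: k_def lins algebra_simps)
      then have "norm (y - f k) = (1 / s) * norm ((y0 + s *\<^sub>R y - f k1) - (y0 - f k2))"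
        using s by simp
      also have "\<dots> \<le> (1 / s) * (e / 8 + e / 8)"
        using k1(3) k2(3) s norm_triangle_ineq4[of "y0 + s *\<^sub>R y - f k1" "y0 - f k2"]
        by (intro mult_left_mono) (auto simp: dist_norm norm_minus_commute)
      also have "\<dots> = norm y / 2" using e False by (simp add: s_def field_simps)
      finally show ?thesis .
    qed
    ultimately show ?thesis by blast
  qed
  then show ?thesis using e by (intro exI[of _ "4 * real n / e"]) auto
qed

lemma surj_bounded_linear_lift:
  fixes f :: "'c::banach \<Rightarrow> 'b::banach"
  assumes f: "bounded_linear f" and K: "subspace K" "closed K" and surj: "f ` K = UNIV"
  shows "\<exists>C\<ge>0. \<forall>y. \<exists>k\<in>K. f k = y \<and> norm k \<le> C * norm y"
proof -
  have lin: "linear f" using f by (rule bounded_linear.linear)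
  note [simp] = linear_0[OF lin] and lins = linear_add[OF lin] linear_diff[OF lin] linear_scale[OF lin]
  obtain M where M: "M \<ge> 0"
    "\<forall>y. \<exists>k\<in>K. norm k \<le> M * norm y \<and> norm (y - f k) \<le> norm y / 2"
    using surj_bounded_linear_approx[OF f K(1) surj] by blast
  then obtain h where h: "\<And>y. h y \<in> K" "\<And>y. norm (h y) \<le> M * norm y"
    "\<And>y. norm (y - f (h y)) \<le> norm y / 2" by metis
  define r where "r y = y - f (h y)" for y
  have "\<exists>k\<in>K. f k = y \<and> norm k \<le> (2 * M) * norm y" for y
  proof -
    define a where "a i = h ((r ^^ i) y)" for i
    have rn: "norm ((r ^^ i) y) \<le> (1/2) ^ i * norm y" for i
      by (rule norm_funpow_le) (use h(3) in \<open>auto simp: r_def\<close>)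
    have an: "norm (a i) \<le> M * norm y * (1/2) ^ i" for i
      using order_trans[OF h(2) mult_left_mono[OF rn[of i] M(1)]] by (simp add: a_def mult_ac)
    have sums: "(\<lambda>i. M * norm y * (1/2) ^ i) sums (2 * M * norm y)"
      using sums_mult[OF geometric_sums[of "1/2::real"], of "M * norm y"] by (simp add: mult_ac)
    have summ: "summable (\<lambda>i. norm (a i))"
      by (rule summable_comparison_test'[OF sums_summable[OF sums], of 0]) (use an in simp)
    have suma: "a sums suminf a" using summable_norm_cancel[OF summ] by (rule summable_sums)
    have "(\<Sum>i<N. a i) \<in> K" for N
      by (rule subspace_sum[OF K(1)]) (simp add: a_def h)
    then have "suminf a \<in> K"
      using suma[unfolded sums_def] by (rule closed_sequentially[OF K(2)])
    moreover have "f (suminf a) = y"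
    proof -
      have part: "f (\<Sum>i<N. a i) = y - (r ^^ N) y" for N
        by (induction N) (simp_all add: lins a_def r_def[of "(r ^^ _) y"])
      have "(\<lambda>N. (1/2) ^ N * norm y) \<longlonglongrightarrow> 0"
        by (rule tendsto_mult_left_zero) (simp add: LIMSEQ_power_zero)
      then have "(\<lambda>N. (r ^^ N) y) \<longlonglongrightarrow> 0"
        by (rule Lim_null_comparison[rotated]) (use rn in simp)
      then have "(\<lambda>N. f (\<Sum>i<N. a i)) \<longlonglongrightarrow> y"
        unfolding part by (auto intro: tendsto_eq_intros)
      moreover have "(\<lambda>N. f (\<Sum>i<N. a i)) \<longlonglongrightarrow> f (suminf a)"
        using suma[unfolded sums_def] by (rule bounded_linear.tendsto[OF f])
      ultimately show ?thesis using LIMSEQ_unique by blast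
    qed
    moreover have "norm (suminf a) \<le> (2 * M) * norm y"
    proof -
      have "norm (suminf a) \<le> (\<Sum>i. norm (a i))" by (rule summable_norm[OF summ])
      also have "\<dots> \<le> (\<Sum>i. M * norm y * (1/2) ^ i)"
        by (rule suminf_le[OF an summ sums_summable[OF sums]])
      also have "\<dots> = 2 * M * norm y" using sums by (simp add: sums_iff)
      finally show ?thesis .
    qed
    ultimately show ?thesis by blast
  qed
  then show ?thesis using M by (intro exI[of _ "2 * M"]) auto
qed

lemma bounded_clinear_inv:
  fixes f :: "'a::complex_banach \<Rightarrow> 'a"
  assumes f: "bounded_clinear f" and bij: "bij f"
  shows "bounded_clinear (inv f)"
proof -
  obtain C where C: "\<forall>y. \<exists>k. f k = y \<and> norm k \<le> C * norm y"
    using surj_bounded_linear_lift[OF bounded_clinear_imp_linear[OF f], of UNIV] bij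
    by (auto simp: bij_def)
  show ?thesis
  proof (rule bounded_clinearI[where K = C])
    show "norm (inv f x) \<le> C * norm x" for x
      using C bij by (metis bij_inv_eq_iff)
    show "inv f (x + y) = inv f x + inv f y" for x y
      using clinear_add[OF f] bij by (metis bij_inv_eq_iff)
    show "inv f (c *\<^sub>C x) = c *\<^sub>C inv f x" for c x
      using clinear_scaleC[OF f] bij by (metis bij_inv_eq_iff)
  qed
qed

lemma resolvent_set_UNIV:
  fixes S :: "'a::complex_banach \<Rightarrow> 'a"
  assumes "bounded_clinear S"
  shows "l \<in> resolvent_set UNIV S \<longleftrightarrow> bij (shift S l)"
  using bounded_clinear_inv[OF bounded_clinear_shift[OF assms]]
  by (auto simp: resolvent_set_def resolvent_def)

lemma bij_id_minus_contraction:
  fixes W :: "'a::complex_banach \<Rightarrow> 'a"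
  assumes W: "bounded_clinear W" and q: "\<And>x. norm (W x) \<le> q * norm x" "q < 1"
  shows "bij (\<lambda>x. x - W x)"
proof -
  define q' where "q' = max q 0"
  have q': "0 \<le> q'" "q' < 1" "\<And>x. norm (W x) \<le> q' * norm x"
    using q by (simp_all add: q'_def, meson max.cobounded1 mult_right_mono norm_ge_zero order_trans)
  have "\<exists>!x. y + W x = x" for y
  proof (rule banach_fix_type[OF q'(1,2)], intro allI)
    show "dist (y + W x) (y + W z) \<le> q' * dist x z" for x z
      using q'(3)[of "x - z"] by (simp add: dist_norm clinear_diff[OF W])
  qed
  then have "\<exists>!x. x - W x = y" for y by (metis add_diff_cancel_right' diff_add_cancel)
  then show ?thesis by (simp add: bij_iff)
qed

subsection \<open>Operators of finite ascent and descent\<close>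

lemma nullspace_stable:
  fixes B :: "'a::zero \<Rightarrow> 'a"
  assumes "\<And>x. (B ^^ Suc n) x = 0 \<Longrightarrow> (B ^^ n) x = 0"
  shows "(B ^^ (k + n)) x = 0 \<Longrightarrow> (B ^^ n) x = 0"
proof (induction k)
  case (Suc k)
  have "(B ^^ (Suc k + n)) x = (B ^^ Suc n) ((B ^^ k) x)"
    by (metis add.commute add_Suc_shift comp_apply funpow_add)
  then have "(B ^^ n) ((B ^^ k) x) = 0" using Suc.prems assms by simp
  then show ?case using Suc.IH by (simp add: add.commute[of k] funpow_add)
qed simp

lemma range_stable:
  fixes B :: "'a \<Rightarrow> 'a"
  assumes "\<And>x. \<exists>y. (B ^^ n) x = (B ^^ Suc n) y"
  shows "\<exists>y. (B ^^ n) x = (B ^^ (k + n)) y"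
proof (induction k)
  case (Suc k)
  then obtain y where y: "(B ^^ n) x = (B ^^ (k + n)) y" by blast
  obtain z where "(B ^^ n) y = (B ^^ Suc n) z" using assms by blast
  with y have "(B ^^ n) x = (B ^^ k) ((B ^^ Suc n) z)" by (simp only: funpow_add comp_apply)
  also have "\<dots> = (B ^^ (Suc k + n)) z" by (metis add.commute add_Suc_shift comp_apply funpow_add)
  finally show ?case by blast
qed auto

lemma Drazin_decomposition:
  fixes B :: "'a::complex_banach \<Rightarrow> 'a"
  assumes B: "bounded_clinear B"
    and nul: "\<And>x. (B ^^ Suc n) x = 0 \<Longrightarrow> (B ^^ n) x = 0"
    and ran: "\<And>x. \<exists>y. (B ^^ n) x = (B ^^ Suc n) y"
  obtains P G where "bounded_clinear P" "bounded_clinear G"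
    "\<And>x. B (G x) = x - P x" "\<And>x. G (B x) = x - P x" "\<And>x. P (B x) = B (P x)"
    "\<And>x. P (G x) = 0" "\<And>x. G (P x) = 0" "\<And>x. (B ^^ n) (P x) = 0"
proof -
  note Bn = bounded_clinear_funpow[OF B]
  note Brules = clinear_rules[OF B] and Bnrules = clinear_rules[OF Bn]
  define splits where "splits x u z \<longleftrightarrow> (B ^^ n) u = 0 \<and> (\<exists>v. z = (B ^^ n) v) \<and> x = u + B z"
    for x u z
  have unique: "u = u' \<and> z = z'" if s: "splits x u z" "splits x u' z'" for x u z u' z'
  proof -
    obtain v v' where v: "z = (B ^^ n) v" "z' = (B ^^ n) v'"
      using s by (auto simp: splits_def)
    define w where "w = v' - v"
    have w: "z' - z = (B ^^ n) w" by (simp add: v w_def Bnrules)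
    have "u - u' = B (z' - z)"
      using s by (simp add: splits_def Brules algebra_simps)
    then have uw: "u - u' = (B ^^ Suc n) w" by (simp add: w)
    have "(B ^^ n) (u - u') = 0" using s by (simp add: splits_def Bnrules)
    then have "(B ^^ (n + Suc n)) w = 0" by (simp add: uw funpow_add funpow_swap1)
    then have "(B ^^ (Suc n + n)) w = 0" by (simp add: add.commute)
    then have "(B ^^ n) w = 0" using nullspace_stable[where B = B, OF nul] by blast
    then show ?thesis using uw w by (simp add: Brules)
  qed
  define K where "K = {u. (B ^^ n) u = 0} \<times> (UNIV :: 'a set)"
  define f where "f p = fst p + (B ^^ Suc n) (snd p)" for p :: "'a \<times> 'a"
  have "bounded_linear f" unfolding f_def
    by (intro bounded_linear_add bounded_linear_fst
        bounded_linear_compose[OF bounded_clinear_imp_linear[OF Bn] bounded_linear_snd])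
  moreover have "subspace K"
    by (auto simp: subspace_def K_def Bnrules scaleR_scaleC zero_prod_def)
  moreover have "closed K" unfolding K_def
  proof (intro closed_Times closed_UNIV)
    show "closed {u. (B ^^ n) u = 0}"
      by (intro closed_Collect_eq continuous_intros
          bounded_linear.continuous_on[OF bounded_clinear_imp_linear[OF Bn]])
  qed
  moreover have "f ` K = UNIV"
  proof -
    have "x \<in> f ` K" for x
    proof -
      obtain y where "(B ^^ n) x = (B ^^ (Suc n + n)) y" using range_stable[where B = B, OF ran] by blast
      then have "(B ^^ n) x = (B ^^ n) ((B ^^ Suc n) y)"
        by (simp only: add.commute[of "Suc n"] funpow_add comp_apply)
      then have "(x - (B ^^ Suc n) y, y) \<in> K" by (simp add: K_def Bnrules)
      then show ?thesis by (rule rev_image_eqI) (simp add: f_def)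
    qed
    then show ?thesis by blast
  qed
  ultimately obtain C where C: "C \<ge> 0" "\<forall>x. \<exists>p\<in>K. f p = x \<and> norm p \<le> C * norm x"
    using surj_bounded_linear_lift by blast
  obtain c where c: "c > 0" "\<And>x. norm ((B ^^ n) x) \<le> c * norm x" using clinear_bound[OF Bn] by blast
  have "\<exists>u z. splits x u z \<and> norm u \<le> C * norm x \<and> norm z \<le> c * C * norm x" for x
  proof -
    obtain u y where p: "(u, y) \<in> K" "f (u, y) = x" "norm (u, y) \<le> C * norm x"
      using C(2) by (metis surj_pair)
    have "splits x u ((B ^^ n) y)"
      using p(1,2) by (auto simp: splits_def K_def f_def)
    moreover have "norm u \<le> C * norm x"
      using p(3) norm_fst_le order_trans by blast
    moreover have "norm y \<le> C * norm x"
      using p(3) norm_snd_le order_trans by blast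
    then have "norm ((B ^^ n) y) \<le> c * C * norm x"
      using order_trans[OF c(2) mult_left_mono[of "norm y" "C * norm x" c]] c(1) by (simp add: mult.assoc)
    ultimately show ?thesis by blast
  qed
  then obtain P G where PG: "\<And>x. splits x (P x) (G x)"
    and Pn: "\<And>x. norm (P x) \<le> C * norm x" and Gn: "\<And>x. norm (G x) \<le> c * C * norm x"
    by metis
  have eqI: "P x = u" "G x = z" if "splits x u z" for x u z
    using unique[OF PG that] by auto
  have add: "splits (x + y) (P x + P y) (G x + G y)" for x y
    using PG[of x] PG[of y] unfolding splits_def
    by (auto simp: Brules Bnrules algebra_simps) (metis Bnrules(2))
  have scale: "splits (c *\<^sub>C x) (c *\<^sub>C P x) (c *\<^sub>C G x)" for c x
    using PG[of x] unfolding splits_def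
    by (auto simp: Brules Bnrules scaleC_add_right[symmetric]) (metis Bnrules(5))
  have Bsplit: "splits (B x) (B (P x)) (B (G x))" for x
    using PG[of x] unfolding splits_def
    by (metis Brules(1,2) funpow_swap1)
  have BG: "B (G x) = x - P x" for x
    using PG[of x] by (simp add: splits_def algebra_simps)
  have "splits (G x) 0 (G (G x))" for x
  proof -
    obtain v where v: "G x = (B ^^ n) v" using PG unfolding splits_def by blast
    obtain w where "(B ^^ n) v = (B ^^ (Suc n)) w" using ran by blast
    then have "splits (G x) 0 ((B ^^ n) w)" by (auto simp: splits_def v Bnrules)
    then show ?thesis using eqI by metis
  qed
  note Gsplit = this
  have Psplit: "splits (P x) (P x) 0" for x
    using PG[of x] unfolding splits_def by (auto simp: Brules Bnrules intro!: exI[of _ 0])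
  show thesis
  proof (rule that)
    show "bounded_clinear P" by (rule bounded_clinearI[OF eqI(1)[OF add] eqI(1)[OF scale] Pn])
    show "bounded_clinear G" by (rule bounded_clinearI[OF eqI(2)[OF add] eqI(2)[OF scale] Gn])
    show "B (G x) = x - P x" for x by (rule BG)
    show "G (B x) = x - P x" for x using eqI(2)[OF Bsplit] BG by simp
    show "P (B x) = B (P x)" for x by (rule eqI(1)[OF Bsplit])
    show "P (G x) = 0" for x by (rule eqI(1)[OF Gsplit])
    show "G (P x) = 0" for x by (rule eqI(2)[OF Psplit])
    show "(B ^^ n) (P x) = 0" for x using PG unfolding splits_def by blast
  qed
qed

subsection \<open>The Laurent expansion of the resolvent\<close>

lemma shift_shift: "shift (shift S z) l = shift S (z + l)"
  by (simp add: shift_def fun_eq_iff scaleC_add_left)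

locale Drazin_split =
  fixes B P G :: "'a::complex_banach \<Rightarrow> 'a" and p :: nat
  assumes B: "bounded_clinear B" and P: "bounded_clinear P" and G: "bounded_clinear G"
    and BG: "\<And>x. B (G x) = x - P x" and GB: "\<And>x. G (B x) = x - P x"
    and PB: "\<And>x. P (B x) = B (P x)" and PG: "\<And>x. P (G x) = 0" and GP: "\<And>x. G (P x) = 0"
    and nilp: "\<And>x. (B ^^ p) (P x) = 0"
begin

definition coeff :: "nat \<Rightarrow> 'a \<Rightarrow> 'a"
  where "coeff k x = (if k < p then - (B ^^ (p - Suc k)) (P x) else (G ^^ Suc (k - p)) x)"

lemma bounded_clinear_coeff: "bounded_clinear (coeff k)"
proof (cases "k < p")
  case True
  then show ?thesis unfolding coeff_def[abs_def] using B P
    by (simp add: bounded_clinear_minus bounded_clinear_comp bounded_clinear_funpow)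
next
  case False
  then show ?thesis unfolding coeff_def[abs_def] if_False using bounded_clinear_funpow[OF G]
    by (simp del: funpow.simps)
qed

lemma B_coeff_0: "p > 0 \<Longrightarrow> B (coeff 0 x) = 0"
  using nilp[of x] funpow.simps(2)[of "p - 1" B] by (simp add: coeff_def clinear_rules[OF B])

lemma B_coeff_Suc:
  assumes "p > 0"
  shows "B (coeff (Suc k) x) = coeff k x + (if Suc k = p then x else 0)"
proof (cases "Suc k" p rule: linorder_cases)
  case less
  then have "p - Suc k = Suc (p - Suc (Suc k))" by simp
  then show ?thesis using less by (simp add: coeff_def clinear_rules[OF B])
next
  case equal
  then have "coeff k x = - P x" "coeff (Suc k) x = G x" by (auto simp: coeff_def)
  then show ?thesis using equal by (simp add: BG)
next
  case greater
  then have "Suc k - p = Suc (k - p)" by simp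
  then show ?thesis using greater by (simp add: coeff_def BG PG)
qed

lemma shift_partial_sum:
  assumes p: "p > 0" and l: "l \<noteq> 0"
  shows "shift B l (\<Sum>k<Suc N. (l powi (int k - int p)) *\<^sub>C coeff k x) =
    (if p \<le> N then x else 0) - (l powi (int (Suc N) - int p)) *\<^sub>C coeff N x"
proof (induction N)
  case 0
  have "l * l powi (- int p) = l powi (1 - int p)"
    using l by (simp add: power_int_diff power_int_minus field_simps)
  then show ?case using p
    by (simp add: shift_def clinear_rules[OF B] B_coeff_0 scaleC_scaleC)
next
  case (Suc N)
  have eq: "l * l powi (int (Suc N) - int p) = l powi (int (Suc (Suc N)) - int p)"
    using l by (simp add: power_int_diff power_int_add field_simps power2_eq_square)
  have "shift B l (\<Sum>k<Suc (Suc N). (l powi (int k - int p)) *\<^sub>C coeff k x) =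
      shift B l (\<Sum>k<Suc N. (l powi (int k - int p)) *\<^sub>C coeff k x) +
      ((l powi (int (Suc N) - int p)) *\<^sub>C B (coeff (Suc N) x)
       - (l * l powi (int (Suc N) - int p)) *\<^sub>C coeff (Suc N) x)"
    by (subst sum.lessThan_Suc)
      (simp add: clinear_add[OF bounded_clinear_shift[OF B]] shift_def[of B l "_ *\<^sub>C _"]
        clinear_scaleC[OF B] scaleC_scaleC del: sum.lessThan_Suc)
  also have "\<dots> = (if p \<le> Suc N then x else 0) -
      (l powi (int (Suc (Suc N)) - int p)) *\<^sub>C coeff (Suc N) x"
    unfolding Suc.IH B_coeff_Suc[OF p] eq
    by (cases "Suc N = p") (auto simp: scaleC_add_right)
  finally show ?case .
qed

lemma bij_shift:
  assumes p: "p > 0" and l: "l \<noteq> 0" and q: "\<And>x. cmod l * norm (G x) \<le> q * norm x" "q < 1"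
  shows "bij (shift B l)"
proof -
  note sh = bounded_clinear_shift[OF B, of l]
  have W: "bij (\<lambda>x. x - l *\<^sub>C G x)"
    by (rule bij_id_minus_contraction[OF bounded_clinear_scaleC[OF G]]) (use q in \<open>simp_all add: norm_scaleC\<close>)
  have "x = 0" if "shift B l x = 0" for x
  proof -
    have Bx: "B x = l *\<^sub>C x" using that by (simp add: shift_def)
    then have "B (P x) = l *\<^sub>C P x" using PB[of x] by (simp add: clinear_scaleC[OF P])
    then have "(B ^^ j) (P x) = (l ^ j) *\<^sub>C P x" for j
      by (induction j) (simp_all add: clinear_scaleC[OF B] scaleC_scaleC mult.commute)
    then have "P x = 0" using nilp[of x] l by simp
    then have "x - l *\<^sub>C G x = 0"
      using GB[of x] by (simp add: Bx clinear_scaleC[OF G])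
    moreover have "0 - l *\<^sub>C G 0 = 0" by (simp add: clinear_rules[OF G])
    ultimately show "x = 0" using injD[OF bij_is_inj[OF W], of x 0] by simp
  qed
  then have "inj (shift B l)"
    using linear_injective_0[OF bounded_linear.linear[OF bounded_clinear_imp_linear[OF sh]]] by blast
  moreover have "\<exists>z. shift B l z = x" for x
  proof -
    obtain y where y: "x = y - l *\<^sub>C G y" using surjD[OF bij_is_surj[OF W]] by blast
    obtain N where N: "p = Suc N" using p by (cases p) auto
    obtain w where "shift B l w = - coeff N y"
      using shift_partial_sum[OF p l, where N = N and x = y] N by auto
    moreover have "coeff N y = - P y" using coeff_def[of N y] N by simp
    ultimately have "shift B l (G y + w) = x"
      by (simp add: clinear_add[OF sh]) (simp add: shift_def BG y)
    then show ?thesis by blast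
  qed
  ultimately show ?thesis unfolding bij_def surj_def by metis
qed

lemma punctured_disc_bij:
  assumes "p > 0"
  obtains g where "g > 0" "\<And>x. norm (G x) \<le> g * norm x"
    "\<And>l. l \<noteq> 0 \<Longrightarrow> cmod l * g < 1 \<Longrightarrow> bij (shift B l)"
proof -
  obtain g where g: "g > 0" "\<And>x. norm (G x) \<le> g * norm x" using clinear_bound[OF G] by blast
  have "bij (shift B l)" if l: "l \<noteq> 0" "cmod l * g < 1" for l
  proof (rule bij_shift[OF assms l(1) _ l(2)])
    show "cmod l * norm (G x) \<le> cmod l * g * norm x" for x
      using mult_left_mono[OF g(2), of "cmod l"] by (simp add: mult_ac)
  qed
  with g show thesis by (rule that)
qed

lemma norm_coeff_le:
  assumes "\<And>x. norm (G x) \<le> g * norm x" "g \<ge> 0" "p \<le> k"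
  shows "norm (coeff k x) \<le> g ^ (Suc k - p) * norm x"
  using norm_funpow_le[OF assms(1,2), of "Suc (k - p)" x] assms(3)
  by (simp add: coeff_def Suc_diff_le del: funpow.simps)

lemma operator_pole_resolvent:
  assumes p: "p > 0" and nz: "coeff 0 \<noteq> (\<lambda>x. 0)" and S: "bounded_clinear S" and BS: "B = shift S z"
  shows "operator_pole (resolvent UNIV S) z"
proof -
  obtain g where g: "g > 0" "\<And>x. norm (G x) \<le> g * norm x"
    "\<And>l. l \<noteq> 0 \<Longrightarrow> cmod l * g < 1 \<Longrightarrow> bij (shift B l)"
    using punctured_disc_bij[OF p] by blast
  have "bounded_clinear (resolvent UNIV S \<mu>) \<and>
    (\<lambda>N. onorm (\<lambda>x. resolvent UNIV S \<mu> x -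
      (\<Sum>k<N. ((\<mu> - z) powi (int k - int p)) *\<^sub>C coeff k x))) \<longlonglongrightarrow> 0"
    if \<mu>: "0 < dist \<mu> z" "dist \<mu> z < 1 / g" for \<mu>
  proof
    define l where "l = \<mu> - z"
    have l: "l \<noteq> 0" "cmod l * g < 1" using \<mu> g(1) by (auto simp: l_def dist_norm field_simps)
    have bij: "bij (shift B l)" by (rule g(3)[OF l])
    define F where "F = inv (shift B l)"
    have F: "bounded_clinear F" unfolding F_def
      by (rule bounded_clinear_inv[OF bounded_clinear_shift[OF B] bij])
    have FR: "resolvent UNIV S \<mu> = F"
      by (simp add: resolvent_def F_def BS shift_shift l_def)
    show "bounded_clinear (resolvent UNIV S \<mu>)" using F FR by simp
    obtain f where f: "f > 0" "\<And>x. norm (F x) \<le> f * norm x" using clinear_bound[OF F] by blast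
    define q where "q = cmod l * g"
    have q: "0 \<le> q" "q < 1" using l g(1) by (auto simp: q_def)
    have err: "norm (F x - (\<Sum>k<Suc N. (l powi (int k - int p)) *\<^sub>C coeff k x))
        \<le> (f * q ^ (Suc N - p)) * norm x" if N: "p \<le> N" for N x
    proof -
      let ?Z = "\<Sum>k<Suc N. (l powi (int k - int p)) *\<^sub>C coeff k x"
      have "?Z = F (shift B l ?Z)" using bij by (simp add: F_def bij_is_inj del: sum.lessThan_Suc)
      also have "\<dots> = F x - F ((l powi (int (Suc N) - int p)) *\<^sub>C coeff N x)"
        using N by (simp add: shift_partial_sum[OF p l(1)] clinear_diff[OF F] del: sum.lessThan_Suc)
      finally have "F x - ?Z = F ((l powi (int (Suc N) - int p)) *\<^sub>C coeff N x)"
        by (simp add: algebra_simps del: sum.lessThan_Suc)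
      moreover have "l powi (int (Suc N) - int p) = l ^ (Suc N - p)"
        using N by (metis le_SucI of_nat_diff power_int_of_nat)
      ultimately have "norm (F x - ?Z) \<le> f * (cmod l ^ (Suc N - p) * norm (coeff N x))"
        using f(2) by (metis norm_scaleC norm_power)
      also have "\<dots> \<le> f * (cmod l ^ (Suc N - p) * (g ^ (Suc N - p) * norm x))"
        using f(1) g norm_coeff_le[OF g(2) _ N] by (intro mult_left_mono) auto
      finally show ?thesis by (simp add: q_def power_mult_distrib mult_ac del: sum.lessThan_Suc)
    qed
    show "(\<lambda>N. onorm (\<lambda>x. resolvent UNIV S \<mu> x -
      (\<Sum>k<N. ((\<mu> - z) powi (int k - int p)) *\<^sub>C coeff k x))) \<longlonglongrightarrow> 0"
      unfolding FR l_def[symmetric]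
    proof (rule LIMSEQ_offset[where k = "Suc p"], rule tendsto_sandwich[OF always_eventually always_eventually])
      let ?E = "\<lambda>N x. F x - (\<Sum>k<N + Suc p. (l powi (int k - int p)) *\<^sub>C coeff k x)"
      show "\<forall>N. 0 \<le> onorm (?E N)"
        by (intro allI onorm_pos_le bounded_clinear_imp_linear bounded_clinear_diff F
            bounded_clinear_sum bounded_clinear_scaleC bounded_clinear_coeff)
      show "\<forall>N. onorm (?E N) \<le> f * q ^ Suc N"
      proof
        show "onorm (?E N) \<le> f * q ^ Suc N" for N
        proof (rule onorm_bound)
          show "0 \<le> f * q ^ Suc N" using f q by simp
          show "norm (?E N x) \<le> f * q ^ Suc N * norm x" for x
            using err[of "N + p" x] by simp
        qed
      qed
      show "(\<lambda>N. f * q ^ Suc N) \<longlonglongrightarrow> 0"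
        by (intro tendsto_mult_right_zero LIMSEQ_Suc LIMSEQ_power_zero) (use q in simp)
    qed (rule tendsto_const)
  qed
  then show ?thesis unfolding operator_pole_def
    using p g(1) nz bounded_clinear_coeff
    by (intro exI[of _ p] exI[of _ coeff] exI[of _ "1 / g"] conjI) auto
qed

end

subsection \<open>Poles of the resolvent\<close>

lemma powser_coeffs_zero:
  fixes c :: "nat \<Rightarrow> 'a::banach"
  assumes r: "r > 0" and sums: "\<And>t. 0 < t \<Longrightarrow> t < r \<Longrightarrow> (\<lambda>k. t ^ k *\<^sub>R c k) sums 0"
  shows "c m = 0"
proof (induction m rule: less_induct)
  case (less m)
  define s where "s = r / 2"
  have s: "0 < s" "s < r" using r by (auto simp: s_def)
  have "(\<lambda>k. s ^ k *\<^sub>R c k) \<longlonglongrightarrow> 0"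
    using sums[OF s] by (intro summable_LIMSEQ_zero sums_summable)
  then have "Bseq (\<lambda>k. s ^ k *\<^sub>R c k)" by (intro convergent_imp_Bseq convergentI)
  then obtain M where M: "M > 0" "\<And>k. norm (s ^ k *\<^sub>R c k) \<le> M" by (auto elim: BseqE)
  have bound: "norm (c m) \<le> (2 * M / s ^ m) * u" if u: "0 < u" "u \<le> 1/2" for u
  proof -
    define t where "t = u * s"
    have "u * s \<le> 1/2 * s" using u s by (intro mult_right_mono) auto
    then have t: "0 < t" "t < r" using u s unfolding t_def by (simp, linarith)
    have "(\<lambda>k. t ^ (k + m) *\<^sub>R c (k + m)) sums (0 - (\<Sum>k<m. t ^ k *\<^sub>R c k))"
      using sums[OF t] by (rule sums_split_initial_segment)
    then have "(\<lambda>k. t ^ (k + m) *\<^sub>R c (k + m)) sums 0"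
      using less by simp
    then have "(\<lambda>k. (1 / t ^ m) *\<^sub>R (t ^ (k + m) *\<^sub>R c (k + m))) sums ((1 / t ^ m) *\<^sub>R 0)"
      by (rule sums_scaleR_right)
    then have "(\<lambda>k. t ^ k *\<^sub>R c (k + m)) sums 0"
      using t by (simp add: power_add)
    then have tail: "(\<lambda>k. t ^ Suc k *\<^sub>R c (Suc k + m)) sums (- c m)"
      by (subst sums_Suc_iff) simp
    have bnd: "norm (t ^ Suc k *\<^sub>R c (Suc k + m)) \<le> (M / s ^ m * u) * u ^ k" for k
    proof -
      have "norm (c (Suc k + m)) \<le> M / s ^ (Suc k + m)"
        using M(2)[of "Suc k + m"] s(1) by (simp add: pos_le_divide_eq mult.commute)
      moreover have "norm (t ^ Suc k *\<^sub>R c (Suc k + m)) = t ^ Suc k * norm (c (Suc k + m))"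
        using t by simp
      ultimately have "norm (t ^ Suc k *\<^sub>R c (Suc k + m)) \<le> t ^ Suc k * (M / s ^ (Suc k + m))"
        using t by (simp only: mult_left_mono zero_le_power less_imp_le)
      also have "\<dots> = (M / s ^ m * u) * u ^ k"
        using s(1) by (simp add: t_def power_mult_distrib power_add field_simps)
      finally show ?thesis .
    qed
    have geo: "(\<lambda>k. (M / s ^ m * u) * u ^ k) sums ((M / s ^ m * u) * (1 / (1 - u)))"
      using u by (intro sums_mult geometric_sums) auto
    have "norm (- c m) \<le> (M / s ^ m * u) * (1 / (1 - u))"
      using norm_suminf_le[OF bnd sums_summable[OF geo]] tail geo
      by (simp add: sums_iff)
    also have "\<dots> \<le> (M / s ^ m * u) * 2"
      using u M(1) s(1) by (intro mult_left_mono) (auto simp: field_simps)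
    finally show ?thesis by (simp add: field_simps)
  qed
  have "((\<lambda>u. (2 * M / s ^ m) * u) \<longlongrightarrow> 0) (at_right 0)"
    by (intro tendsto_mult_right_zero tendsto_ident_at)
  moreover have "\<forall>\<^sub>F u in at_right 0. norm (c m) \<le> (2 * M / s ^ m) * u"
    by (rule eventually_mono[OF eventually_at_right_real[of 0 "1/2"]], simp, rule bound) simp_all
  ultimately have "norm (c m) \<le> 0"
    by (intro tendsto_lowerbound) auto
  then show ?case by simp
qed

lemma operator_pole_imp_Drazin:
  fixes S :: "'a::complex_banach \<Rightarrow> 'a"
  assumes S: "bounded_clinear S" and pole: "operator_pole (resolvent UNIV S) z"
    and e: "e > 0" "\<And>\<mu>. 0 < dist \<mu> z \<Longrightarrow> dist \<mu> z < e \<Longrightarrow> bij (shift S \<mu>)"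
  defines "B \<equiv> shift S z"
  obtains n C where "bounded_clinear C"
    "\<And>x. (B ^^ n) x = (B ^^ Suc n) (C x)" "\<And>x. (B ^^ n) x = C ((B ^^ Suc n) x)"
proof -
  obtain n A r where n: "n \<ge> 1" and r: "r > 0" and A: "\<And>k. bounded_clinear (A k)"
    and F: "\<forall>\<mu>. 0 < dist \<mu> z \<and> dist \<mu> z < r \<longrightarrow> bounded_clinear (resolvent UNIV S \<mu>) \<and>
        (\<lambda>N. onorm (\<lambda>x. resolvent UNIV S \<mu> x - (\<Sum>k<N. ((\<mu> - z) powi (int k - int n)) *\<^sub>C A k x)))
          \<longlonglongrightarrow> 0"
    using pole unfolding operator_pole_def by (elim exE conjE) blast
  have B: "bounded_clinear B" unfolding B_def by (rule bounded_clinear_shift[OF S])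
  define A' where "A' k x = (case k of 0 \<Rightarrow> 0 | Suc j \<Rightarrow> A j x)" for k x
  define R where "R l = resolvent UNIV S (z + l)" for l
  have inverse: "R l (B x) = x + l *\<^sub>C R l x" "B (R l x) = x + l *\<^sub>C R l x"
    and expand: "(\<lambda>k. l ^ k *\<^sub>C A k x) sums (l ^ n *\<^sub>C R l x)"
    if l: "0 < cmod l" "cmod l < min r e" for l x
  proof -
    have d: "0 < dist (z + l) z" "dist (z + l) z < r" "dist (z + l) z < e"
      using l by (auto simp: dist_norm)
    note Rl = F[rule_format, OF conjI[OF d(1,2)], folded R_def]
    have Rc: "bounded_clinear (R l)" using Rl by blast
    have bij: "bij (shift S (z + l))" by (rule e(2)[OF d(1,3)])
    have sh: "shift S (z + l) y = B y - l *\<^sub>C y" for y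
      by (simp add: B_def shift_def scaleC_add_left)
    have "R l (shift S (z + l) x) = x" "shift S (z + l) (R l x) = x"
      using bij by (simp_all add: R_def resolvent_def bij_is_inj bij_is_surj surj_f_inv_f)
    then show "R l (B x) = x + l *\<^sub>C R l x" "B (R l x) = x + l *\<^sub>C R l x"
      unfolding sh by (simp_all add: clinear_rules[OF Rc] diff_eq_eq)
    define E where "E N x = R l x - (\<Sum>k<N. (l powi (int k - int n)) *\<^sub>C A k x)" for N x
    have "(\<lambda>N. onorm (E N)) \<longlonglongrightarrow> 0" using Rl unfolding E_def[abs_def] by simp
    then have lim: "(\<lambda>N. onorm (E N) * norm x) \<longlonglongrightarrow> 0" by (rule tendsto_mult_left_zero)
    have "bounded_linear (E N)" for N unfolding E_def[abs_def]
      by (intro bounded_clinear_imp_linear bounded_clinear_diff Rc bounded_clinear_sum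
          bounded_clinear_scaleC A)
    then have "norm (E N x) \<le> onorm (E N) * norm x" for N by (rule onorm)
    then have "(\<lambda>N. E N x) \<longlonglongrightarrow> 0"
      by (intro Lim_null_comparison[OF always_eventually lim]) blast
    then have "(\<lambda>N. R l x - E N x) \<longlonglongrightarrow> R l x" by (auto intro: tendsto_eq_intros)
    then have "(\<lambda>k. (l powi (int k - int n)) *\<^sub>C A k x) sums R l x"
      by (simp add: E_def sums_def)
    from bounded_linear.sums[OF bounded_linear_scaleC_right this, of "l ^ n"]
    show "(\<lambda>k. l ^ k *\<^sub>C A k x) sums (l ^ n *\<^sub>C R l x)"
      using l by (simp add: scaleC_scaleC power_int_diff)
  qed
  have shifted: "(\<lambda>k. l ^ k *\<^sub>C A' k x) sums (l ^ n *\<^sub>C l *\<^sub>C R l x)"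
    if "0 < cmod l" "cmod l < min r e" for l x
  proof -
    have "(\<lambda>k. l ^ Suc k *\<^sub>C A' (Suc k) x) sums (l *\<^sub>C l ^ n *\<^sub>C R l x)"
      using bounded_linear.sums[OF bounded_linear_scaleC_right expand[OF that, of x], of l]
      by (simp add: A'_def scaleC_scaleC)
    from sums_Suc[OF this] show ?thesis by (simp add: A'_def scaleC_scaleC mult.commute)
  qed
  have single: "(\<lambda>k. l ^ k *\<^sub>C (if k = n then x else 0)) sums (l ^ n *\<^sub>C x)" for l and x :: 'a
    using sums_single[of n "\<lambda>k. l ^ k *\<^sub>C x"] by (rule back_subst[of "\<lambda>f. f sums _"]) auto
  have zero: "c k = 0"
    if c0: "\<And>l. 0 < cmod l \<Longrightarrow> cmod l < min r e \<Longrightarrow> (\<lambda>k. l ^ k *\<^sub>C c k) sums 0"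
    for c :: "nat \<Rightarrow> 'a" and k
  proof (rule powser_coeffs_zero[of "min r e"])
    show "(\<lambda>k. t ^ k *\<^sub>R c k) sums 0" if "0 < t" "t < min r e" for t
      using that c0[of "complex_of_real t"] by (simp add: scaleR_scaleC)
  qed (use r e in simp)
  have BA: "B (A k x) = A' k x + (if k = n then x else 0)" for k x
  proof -
    have "B (A k x) - A' k x - (if k = n then x else 0) = 0"
    proof (rule zero[of "\<lambda>k. B (A k x) - A' k x - (if k = n then x else 0)"])
      fix l assume l: "0 < cmod l" "cmod l < min r e"
      have "(\<lambda>k. l ^ k *\<^sub>C B (A k x)) sums (l ^ n *\<^sub>C B (R l x))"
        using bounded_linear.sums[OF bounded_clinear_imp_linear[OF B] expand[OF l, of x]]
        by (simp add: clinear_rules[OF B])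
      from sums_diff[OF sums_diff[OF this shifted[OF l, of x]] single[of l x]]
      show "(\<lambda>k. l ^ k *\<^sub>C (B (A k x) - A' k x - (if k = n then x else 0))) sums 0"
        by (simp add: scaleC_diff_right scaleC_add_right inverse[OF l])
    qed
    then show ?thesis by (simp add: algebra_simps)
  qed
  have AB: "A k (B x) = A' k x + (if k = n then x else 0)" for k x
  proof -
    have "A k (B x) - A' k x - (if k = n then x else 0) = 0"
    proof (rule zero[of "\<lambda>k. A k (B x) - A' k x - (if k = n then x else 0)"])
      fix l assume l: "0 < cmod l" "cmod l < min r e"
      from sums_diff[OF sums_diff[OF expand[OF l, of "B x"] shifted[OF l, of x]] single[of l x]]
      show "(\<lambda>k. l ^ k *\<^sub>C (A k (B x) - A' k x - (if k = n then x else 0))) sums 0"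
        by (simp add: scaleC_diff_right scaleC_add_right inverse[OF l])
    qed
    then show ?thesis by (simp add: algebra_simps)
  qed
  have BA0: "k < n \<Longrightarrow> (B ^^ Suc k) (A k x) = 0" for k x
  proof (induction k)
    case 0
    then show ?case using BA[of 0 x] by (simp add: A'_def)
  next
    case (Suc k)
    then show ?case
      using BA[of "Suc k" x] by (subst funpow_Suc_right) (simp add: A'_def)
  qed
  have AB0: "k < n \<Longrightarrow> A k ((B ^^ Suc k) x) = 0" for k x
  proof (induction k)
    case 0
    then show ?case using AB[of 0 x] by (simp add: A'_def)
  next
    case (Suc k)
    then show ?case
      using AB[of "Suc k" "(B ^^ Suc k) x"] by (simp add: A'_def)
  qed
  obtain m where m: "n = Suc m" using n by (cases n) auto
  have "(B ^^ n) x = (B ^^ Suc n) (A n x)" for x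
  proof -
    have "(B ^^ Suc n) (A n x) = (B ^^ n) (A m x + x)"
      using BA[of n x] by (simp add: m A'_def funpow_swap1)
    also have "\<dots> = (B ^^ n) x"
      using BA0[of m x] by (simp add: m clinear_add[OF bounded_clinear_funpow[OF B]] del: funpow.simps)
    finally show ?thesis by simp
  qed
  moreover have "(B ^^ n) x = A n ((B ^^ Suc n) x)" for x
    using AB[of n "(B ^^ n) x"] AB0[of m x] by (simp add: m A'_def)
  ultimately show thesis using that A by blast
qed

subsection \<open>Powers of an unbounded operator and of its resolvent\<close>

lemma ascent_finite_iff:
  "ascent D T \<noteq> \<infinity> \<longleftrightarrow> (\<exists>n. nullspace_power D T n = nullspace_power D T (Suc n))"
  unfolding ascent_def top_enat_def[symmetric] Inf_top_conv by (auto simp: top_enat_def)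

lemma descent_finite_iff:
  "descent D T \<noteq> \<infinity> \<longleftrightarrow> (\<exists>n. range_power D T n = range_power D T (Suc n))"
  unfolding descent_def top_enat_def[symmetric] Inf_top_conv by (auto simp: top_enat_def)

lemma nullspace_power_UNIV: "nullspace_power UNIV B n = {x. (B ^^ n) x = 0}"
  by (simp add: nullspace_power_def power_domain_def)

lemma range_power_UNIV: "range_power UNIV B n = range (B ^^ n)"
  by (simp add: range_power_def power_domain_def)

lemma Drazin_invertible_UNIV_imp:
  assumes "Drazin_invertible UNIV B"
  obtains n where "\<And>x. (B ^^ Suc n) x = 0 \<Longrightarrow> (B ^^ n) x = 0"
    "\<And>x. \<exists>y. (B ^^ n) x = (B ^^ Suc n) y"
proof -
  obtain i j where i: "{x. (B ^^ i) x = 0} = {x. (B ^^ Suc i) x = 0}"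
    and j: "range (B ^^ j) = range (B ^^ Suc j)"
    using assms unfolding Drazin_invertible_def ascent_finite_iff descent_finite_iff
      nullspace_power_UNIV range_power_UNIV by blast
  have nul: "(B ^^ (i + j)) x = 0" if "(B ^^ Suc (i + j)) x = 0" for x
  proof -
    have "(B ^^ Suc i) ((B ^^ j) x) = 0" using that by (simp add: funpow_add)
    then have "(B ^^ i) ((B ^^ j) x) = 0" using i by blast
    then show ?thesis by (simp add: funpow_add)
  qed
  have "\<exists>y. (B ^^ (i + j)) x = (B ^^ Suc (i + j)) y" for x
  proof -
    obtain y where "(B ^^ j) x = (B ^^ Suc j) y" using j by blast
    then have "(B ^^ (i + j)) x = (B ^^ (i + Suc j)) y" by (simp only: funpow_add comp_apply)
    then show ?thesis by auto
  qed
  with nul show thesis by (rule that)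
qed

lemma power_domain_Suc: "power_domain D U (Suc n) = {x \<in> D. U x \<in> power_domain D U n}"
  by (auto simp: power_domain_def All_less_Suc2 funpow_swap1)

locale resolvent_at =
  fixes D :: "'a::complex_banach set" and T :: "'a \<Rightarrow> 'a" and l0 :: complex
  assumes T: "linear_operator D T" and l0: "l0 \<in> resolvent_set D T"
begin

definition S :: "'a \<Rightarrow> 'a" where "S = resolvent D T l0"

lemma S: "bounded_clinear S"
  using l0 by (simp add: resolvent_set_def S_def)

lemma S_in [simp]: "S y \<in> D" and T_S: "T (S y) = y + l0 *\<^sub>C S y"
  and S_T: "x \<in> D \<Longrightarrow> S (T x - l0 *\<^sub>C x) = x"
proof -
  have bij: "bij_betw (shift T l0) D UNIV" using l0 by (simp add: resolvent_set_def)
  show "S y \<in> D" unfolding S_def resolvent_def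
    using bij by (metis UNIV_I bij_betw_def inv_into_into)
  have "shift T l0 (S y) = y" unfolding S_def resolvent_def
    using bij by (metis UNIV_I bij_betw_inv_into_right)
  then show "T (S y) = y + l0 *\<^sub>C S y" by (simp add: shift_def diff_eq_eq)
  show "x \<in> D \<Longrightarrow> S (T x - l0 *\<^sub>C x) = x"
    using bij_betw_inv_into_left[OF bij] by (simp add: S_def resolvent_def shift_def)
qed

context
  fixes l :: complex
  assumes l: "l \<noteq> l0"
begin

abbreviation "U \<equiv> shift T l"
abbreviation "V \<equiv> shift S (1 / (l - l0))"

lemma V: "bounded_clinear V"
  by (rule bounded_clinear_shift[OF S])

lemma V_power: "bounded_clinear (V ^^ n)" and S_power: "bounded_clinear (S ^^ n)"
  by (rule bounded_clinear_funpow, rule V S)+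

lemma S_V: "S (V x) = V (S x)"
  by (simp add: shift_def clinear_rules[OF S])

lemma S_V_power: "S ((V ^^ n) x) = (V ^^ n) (S x)"
  by (induction n) (simp_all add: S_V)

lemma S_power_V_power: "(S ^^ m) ((V ^^ n) x) = (V ^^ n) ((S ^^ m) x)"
  by (induction m) (simp_all add: S_V_power)

lemma U_S: "U (S y) = (l0 - l) *\<^sub>C V y"
proof -
  have inv: "(l0 - l) * (1 / (l - l0)) = - 1" using l by (simp add: field_simps)
  have "(l0 - l) *\<^sub>C V y = (l0 - l) *\<^sub>C S y - ((l0 - l) * (1 / (l - l0))) *\<^sub>C y"
    by (simp only: shift_def scaleC_diff_right scaleC_scaleC)
  then show ?thesis unfolding inv by (simp add: shift_def T_S scaleC_diff_left)
qed

lemma U_power_S_power: "(U ^^ n) ((S ^^ n) y) = ((l0 - l) ^ n) *\<^sub>C (V ^^ n) y"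
proof (induction n arbitrary: y)
  case (Suc n)
  have "(U ^^ Suc n) ((S ^^ Suc n) y) = (U ^^ n) (U (S ((S ^^ n) y)))"
    by (simp add: funpow_swap1)
  also have "U (S ((S ^^ n) y)) = (S ^^ n) ((l0 - l) *\<^sub>C V y)"
    using S_power_V_power[of n 1 y] by (simp add: U_S clinear_rules[OF S_power])
  finally show ?case
    by (simp add: Suc.IH clinear_rules[OF V_power] scaleC_scaleC funpow_swap1 mult.commute)
qed simp

lemma S_resolvent_identity: "x \<in> D \<Longrightarrow> x = S (U x + (l - l0) *\<^sub>C x)"
  using S_T[of x] by (simp add: shift_def scaleC_diff_left algebra_simps)

lemma power_domain_eq: "power_domain D U n = range (S ^^ n)"
proof (induction n)
  case 0
  show ?case by (simp add: power_domain_def)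
next
  case (Suc n)
  show ?case
  proof (intro equalityI subsetI)
    fix x assume x: "x \<in> power_domain D U (Suc n)"
    then have "x \<in> D" "U x \<in> power_domain D U n" by (auto simp: power_domain_Suc)
    moreover have "x \<in> power_domain D U n" using x by (simp add: power_domain_def)
    ultimately obtain a b where "U x = (S ^^ n) a" "x = (S ^^ n) b"
      unfolding Suc.IH by blast
    then have "U x + (l - l0) *\<^sub>C x = (S ^^ n) (a + (l - l0) *\<^sub>C b)"
      by (simp add: clinear_rules[OF S_power])
    then have "x = (S ^^ Suc n) (a + (l - l0) *\<^sub>C b)"
      using S_resolvent_identity[OF \<open>x \<in> D\<close>] by simp
    then show "x \<in> range (S ^^ Suc n)" by blast
  next
    fix x assume "x \<in> range (S ^^ Suc n)"
    then obtain y where y: "x = S ((S ^^ n) y)" by auto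
    have "U x = (S ^^ n) ((l0 - l) *\<^sub>C V y)"
      using S_power_V_power[of n 1 y] by (simp add: y U_S clinear_rules[OF S_power])
    then show "x \<in> power_domain D U (Suc n)"
      using Suc.IH by (simp add: power_domain_Suc y)
  qed
qed

lemma range_power_eq: "range_power D U n = range_power UNIV V n"
proof (intro equalityI subsetI)
  fix x assume "x \<in> range_power D U n"
  then obtain y where "x = (U ^^ n) ((S ^^ n) y)"
    by (auto simp: range_power_def power_domain_eq)
  then have "x = (V ^^ n) (((l0 - l) ^ n) *\<^sub>C y)"
    by (simp add: U_power_S_power clinear_rules[OF V_power])
  then show "x \<in> range_power UNIV V n" by (simp add: range_power_UNIV)
next
  fix x assume "x \<in> range_power UNIV V n"
  then obtain y where "x = (V ^^ n) y" by (auto simp: range_power_UNIV)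
  then have "x = (U ^^ n) ((S ^^ n) ((1 / (l0 - l) ^ n) *\<^sub>C y))"
    using l by (simp add: U_power_S_power clinear_rules[OF V_power] scaleC_scaleC)
  then show "x \<in> range_power D U n" by (auto simp: range_power_def power_domain_eq)
qed

lemma nullspace_S_surj: "(V ^^ n) x = 0 \<Longrightarrow> \<exists>w. (V ^^ n) w = 0 \<and> S w = x"
proof (induction n arbitrary: x)
  case 0
  then show ?case by (auto simp: clinear_rules[OF S])
next
  case (Suc n)
  then have "(V ^^ n) (V x) = 0" by (simp add: funpow_swap1)
  then obtain w where w: "(V ^^ n) w = 0" "S w = V x" using Suc.IH by blast
  have "S ((l - l0) *\<^sub>C (x - w)) = (l - l0) *\<^sub>C (S x - V x)"
    by (simp add: clinear_rules[OF S] w)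
  also have "\<dots> = x" using l by (simp add: shift_def scaleC_scaleC)
  finally have "S ((l - l0) *\<^sub>C (x - w)) = x" .
  moreover have "(V ^^ Suc n) ((l - l0) *\<^sub>C (x - w)) = 0"
    using Suc.prems w(1) by (simp add: clinear_rules[OF V_power] clinear_rules[OF V])
  ultimately show ?case by blast
qed

lemma nullspace_power_eq: "nullspace_power D U n = nullspace_power UNIV V n"
proof (intro equalityI subsetI)
  fix x assume "x \<in> nullspace_power D U n"
  then obtain y where y: "x = (S ^^ n) y" "(U ^^ n) ((S ^^ n) y) = 0"
    by (auto simp: nullspace_power_def power_domain_eq)
  then have "(V ^^ n) y = 0" using l by (simp add: U_power_S_power)
  then show "x \<in> nullspace_power UNIV V n"
    by (simp add: nullspace_power_UNIV y(1) clinear_rules[OF S_power] flip: S_power_V_power)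
next
  fix x assume "x \<in> nullspace_power UNIV V n"
  then have x: "(V ^^ n) x = 0" by (simp add: nullspace_power_UNIV)
  have "\<exists>y. (V ^^ n) y = 0 \<and> (S ^^ m) y = x" for m
  proof (induction m)
    case (Suc m)
    then obtain y where y: "(V ^^ n) y = 0" "(S ^^ m) y = x" by blast
    then obtain w where "(V ^^ n) w = 0" "S w = y" using nullspace_S_surj by blast
    then show ?case using y by (auto simp: funpow_swap1)
  qed (use x in auto)
  then obtain y where "(V ^^ n) y = 0" "(S ^^ n) y = x" by blast
  then show "x \<in> nullspace_power D U n"
    by (auto simp: nullspace_power_def power_domain_eq U_power_S_power)
qed

lemma Drazin_invertible_iff: "Drazin_invertible D U \<longleftrightarrow> Drazin_invertible UNIV V"
  by (simp add: Drazin_invertible_def ascent_def descent_def range_power_eq nullspace_power_eq)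

lemma linear_on_U: "x \<in> D \<Longrightarrow> y \<in> D \<Longrightarrow> x - y \<in> D \<and> U (x - y) = U x - U y"
proof -
  assume xy: "x \<in> D" "y \<in> D"
  have y: "- y \<in> D \<and> T (- y) = - T y"
    using T xy(2) scaleC_minus_left[of 1] unfolding linear_operator_def by (metis scaleC_one)
  have "x + - y \<in> D \<and> T (x + - y) = T x + T (- y)"
    using T xy(1) y unfolding linear_operator_def by blast
  then show ?thesis using y by (simp add: shift_def scaleC_diff_right)
qed

lemma bij_iff: "bij_betw U D UNIV \<longleftrightarrow> bij V"
proof -
  have ran: "U ` D = range V"
    using range_power_eq[of 1] by (simp add: range_power_def power_domain_def)
  have nul: "{x \<in> D. U x = 0} = {x. V x = 0}"
    using nullspace_power_eq[of 1] by (simp add: nullspace_power_def power_domain_def)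
  have "inj_on U D \<longleftrightarrow> {x \<in> D. U x = 0} \<subseteq> {0}"
  proof
    have "0 \<in> D" "U 0 = 0"
      using S_in[of 0] T_S[of 0] by (simp_all add: clinear_rules[OF S] shift_def)
    then show "{x \<in> D. U x = 0} \<subseteq> {0}" if "inj_on U D"
    proof (intro subsetI)
      fix x assume "x \<in> {x \<in> D. U x = 0}"
      then have "x = 0" using inj_onD[OF that, of x 0] \<open>0 \<in> D\<close> \<open>U 0 = 0\<close> by simp
      then show "x \<in> {0}" by simp
    qed
    show "inj_on U D" if "{x \<in> D. U x = 0} \<subseteq> {0}"
    proof (rule inj_onI)
      fix x y assume "x \<in> D" "y \<in> D" "U x = U y"
      then have "x - y \<in> {x \<in> D. U x = 0}" using linear_on_U by simp
      then show "x = y" using that by auto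
    qed
  qed
  moreover have "inj V \<longleftrightarrow> {x. V x = 0} \<subseteq> {0}"
    using linear_injective_0[OF bounded_linear.linear[OF bounded_clinear_imp_linear[OF V]]] by blast
  ultimately show ?thesis by (simp add: bij_betw_def ran nul)
qed

lemma spectrum_iff: "l \<in> spectrum D T \<longleftrightarrow> 1 / (l - l0) \<in> spectrum UNIV S"
proof -
  have "bounded_clinear (resolvent D T l)" if bij: "bij V"
  proof -
    have "resolvent D T l = (\<lambda>x. (1 / (l0 - l)) *\<^sub>C S (inv V x))"
    proof
      fix x
      have "(1 / (l0 - l)) *\<^sub>C S (inv V x) = S ((1 / (l0 - l)) *\<^sub>C inv V x)"
        by (simp add: clinear_rules[OF S])
      moreover have "U (S ((1 / (l0 - l)) *\<^sub>C inv V x)) = x"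
        using l bij by (simp add: U_S clinear_rules[OF V] scaleC_scaleC bij_is_surj surj_f_inv_f)
      moreover have "inj_on U D" using bij bij_iff by (simp add: bij_betw_def)
      ultimately show "resolvent D T l x = (1 / (l0 - l)) *\<^sub>C S (inv V x)"
        unfolding resolvent_def by (intro inv_into_f_eq) simp_all
    qed
    then show ?thesis
      using bounded_clinear_scaleC[OF bounded_clinear_comp[OF S bounded_clinear_inv[OF V bij]]] by simp
  qed
  then have "l \<in> resolvent_set D T \<longleftrightarrow> bij V"
    using bij_iff by (auto simp: resolvent_set_def)
  then show ?thesis by (simp add: spectrum_def resolvent_set_UNIV[OF S])
qed

end

end

subsection \<open>Meromorphic operators\<close>

lemma Drazin_invertible_UNIV_bij:
  fixes B :: "'a::complex_banach \<Rightarrow> 'a"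
  assumes B: "bounded_clinear B" and bij: "bij B"
  shows "Drazin_invertible UNIV B"
proof -
  have "x = 0" if "B x = 0" for x
    using injD[OF bij_is_inj[OF bij], of x 0] that by (simp add: clinear_zero[OF B])
  then have "nullspace_power UNIV B 0 = nullspace_power UNIV B (Suc 0)"
    by (auto simp: nullspace_power_UNIV clinear_zero[OF B])
  moreover have "range_power UNIV B 0 = range_power UNIV B (Suc 0)"
    using bij by (simp add: range_power_UNIV bij_is_surj)
  ultimately show ?thesis
    unfolding Drazin_invertible_def ascent_finite_iff descent_finite_iff by blast
qed

lemma Drazin_invertible_UNIV_split:
  fixes B :: "'a::complex_banach \<Rightarrow> 'a"
  assumes "bounded_clinear B" and "Drazin_invertible UNIV B"
  obtains P G n where "Drazin_split B P G n"
proof -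
  obtain n where n: "\<And>x. (B ^^ Suc n) x = 0 \<Longrightarrow> (B ^^ n) x = 0"
    "\<And>x. \<exists>y. (B ^^ n) x = (B ^^ Suc n) y"
    using Drazin_invertible_UNIV_imp[OF assms(2)] by blast
  show thesis
    by (rule Drazin_decomposition[OF assms(1) n], assumption,
        rule that, rule Drazin_split.intro[OF assms(1)])
qed

lemma (in Drazin_split) Drazin_split_least:
  assumes "\<not> bij B"
  obtains q where "Drazin_split B P G q" "q > 0" "Drazin_split.coeff B P G q 0 \<noteq> (\<lambda>x. 0)"
proof -
  define q where "q = (LEAST q. \<forall>x. (B ^^ q) (P x) = 0)"
  have q: "\<forall>x. (B ^^ q) (P x) = 0"
    unfolding q_def by (rule LeastI[of _ p]) (simp add: nilp)
  have pos: "q > 0"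
  proof (rule ccontr)
    assume "\<not> q > 0"
    then have "P x = 0" for x using q by simp
    then have "bij B" by (intro o_bij[of G]) (auto simp: fun_eq_iff BG GB)
    with assms show False ..
  qed
  interpret q: Drazin_split B P G q
    using q by unfold_locales (simp_all add: B P G BG GB PB PG GP)
  have "\<not> (\<forall>x. (B ^^ (q - 1)) (P x) = 0)"
    using not_less_Least[of "q - 1" "\<lambda>q. \<forall>x. (B ^^ q) (P x) = 0"] pos by (simp add: q_def)
  then have "q.coeff 0 \<noteq> (\<lambda>x. 0)"
    using pos by (auto simp: q.coeff_def fun_eq_iff)
  then show thesis by (rule that[OF q.Drazin_split_axioms pos])
qed

lemma meromorphic_operator_iff_Drazin:
  fixes S :: "'a::complex_banach \<Rightarrow> 'a"
  assumes S: "bounded_clinear S"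
  shows "meromorphic_operator S \<longleftrightarrow>
    (\<forall>z\<in>spectrum UNIV S. z \<noteq> 0 \<longrightarrow> Drazin_invertible UNIV (shift S z))"
proof
  assume mero: "meromorphic_operator S"
  show "\<forall>z\<in>spectrum UNIV S. z \<noteq> 0 \<longrightarrow> Drazin_invertible UNIV (shift S z)"
  proof (intro ballI impI)
    fix z assume z: "z \<in> spectrum UNIV S" "z \<noteq> 0"
    then have iso: "z isolated_in spectrum UNIV S"
      using mero by (auto simp: meromorphic_operator_def isolated_in_islimpt_iff)
    then have pole: "operator_pole (resolvent UNIV S) z"
      using mero z(2) by (simp add: meromorphic_operator_def)
    obtain e where e: "e > 0" "\<forall>y\<in>spectrum UNIV S. dist z y < e \<longrightarrow> y = z"
      using iso unfolding isolated_in_dist_Ex_iff by blast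
    have bij: "bij (shift S \<mu>)" if "0 < dist \<mu> z" "dist \<mu> z < e" for \<mu>
    proof -
      have "\<mu> \<notin> spectrum UNIV S" using that e(2) by (auto simp: dist_commute)
      then show ?thesis by (simp add: spectrum_def resolvent_set_UNIV[OF S])
    qed
    obtain n C where C: "bounded_clinear C"
      "\<And>x. (shift S z ^^ n) x = (shift S z ^^ Suc n) (C x)"
      "\<And>x. (shift S z ^^ n) x = C ((shift S z ^^ Suc n) x)"
      by (rule operator_pole_imp_Drazin[OF S pole e(1) bij], assumption+, rule that)
    note zero = clinear_zero[OF bounded_clinear_shift[OF S, of z]]
    have "nullspace_power UNIV (shift S z) n = nullspace_power UNIV (shift S z) (Suc n)"
      unfolding nullspace_power_UNIV
    proof (intro equalityI Collect_mono impI)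
      show "(shift S z ^^ Suc n) x = 0" if "(shift S z ^^ n) x = 0" for x
        using that by (simp add: zero)
      show "(shift S z ^^ n) x = 0" if "(shift S z ^^ Suc n) x = 0" for x
        using C(3)[of x] that clinear_zero[OF C(1)] by simp
    qed
    moreover have "range_power UNIV (shift S z) n = range_power UNIV (shift S z) (Suc n)"
      unfolding range_power_UNIV
    proof (intro equalityI image_subsetI)
      show "(shift S z ^^ n) x \<in> range (shift S z ^^ Suc n)" for x
        using C(2)[of x] by (rule range_eqI)
      show "(shift S z ^^ Suc n) x \<in> range (shift S z ^^ n)" for x
        by (rule range_eqI[of _ _ "shift S z x"]) (simp add: funpow_swap1)
    qed
    ultimately show "Drazin_invertible UNIV (shift S z)"
      unfolding Drazin_invertible_def ascent_finite_iff descent_finite_iff by blast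
  qed
next
  assume Drazin: "\<forall>z\<in>spectrum UNIV S. z \<noteq> 0 \<longrightarrow> Drazin_invertible UNIV (shift S z)"
  have split: "\<exists>P G n. Drazin_split (shift S z) P G n" if "z \<noteq> 0" for z
  proof -
    have "Drazin_invertible UNIV (shift S z)"
      using Drazin that Drazin_invertible_UNIV_bij[OF bounded_clinear_shift[OF S]]
        resolvent_set_UNIV[OF S, of z] by (auto simp: spectrum_def)
    then show ?thesis
      by (rule Drazin_invertible_UNIV_split[OF bounded_clinear_shift[OF S]]) blast
  qed
  have "\<not> z islimpt spectrum UNIV S" if z: "z \<noteq> 0" for z
  proof -
    obtain P G n where "Drazin_split (shift S z) P G n" using split[OF z] by blast
    then interpret Drazin_split "shift S z" P G n .
    interpret suc: Drazin_split "shift S z" P G "Suc n"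
      by unfold_locales (simp_all add: B P G BG GB PB PG GP nilp clinear_zero[OF B])
    obtain g where g: "g > 0"
      "\<And>l. l \<noteq> 0 \<Longrightarrow> cmod l * g < 1 \<Longrightarrow> bij (shift (shift S z) l)"
      by (rule suc.punctured_disc_bij) (simp, rule that)
    have "\<mu> \<notin> spectrum UNIV S" if "\<mu> \<noteq> z" "dist \<mu> z < 1 / g" for \<mu>
      using g(2)[of "\<mu> - z"] that g(1)
      by (simp add: spectrum_def resolvent_set_UNIV[OF S] shift_shift dist_norm pos_less_divide_eq)
    moreover have "1 / g > 0" using g(1) by simp
    ultimately show ?thesis unfolding islimpt_approachable by blast
  qed
  moreover have "operator_pole (resolvent UNIV S) z"
    if z: "z \<noteq> 0" "z isolated_in spectrum UNIV S" for z
  proof -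
    have not_bij: "\<not> bij (shift S z)"
      using z(2) by (auto simp: isolated_in_def spectrum_def resolvent_set_UNIV[OF S])
    obtain P G n where "Drazin_split (shift S z) P G n" using split[OF z(1)] by blast
    from Drazin_split.Drazin_split_least[OF this not_bij]
    obtain q where q: "Drazin_split (shift S z) P G q" "q > 0"
      "Drazin_split.coeff (shift S z) P G q 0 \<noteq> (\<lambda>x. 0)" .
    show ?thesis by (rule Drazin_split.operator_pole_resolvent[OF q S refl])
  qed
  ultimately show "meromorphic_operator S"
    using S unfolding meromorphic_operator_def by blast
qed

lemma (in resolvent_at) purely_B_discrete_iff_meromorphic:
  "purely_B_discrete_spectrum D T \<longleftrightarrow> meromorphic_operator S"
proof -
  have "purely_B_discrete_spectrum D T \<longleftrightarrow>
      (\<forall>l\<in>spectrum D T. Drazin_invertible D (shift T l))"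
    by (auto simp: purely_B_discrete_spectrum_def B_discrete_spectrum_def Drazin_spectrum_def)
  also have "\<dots> \<longleftrightarrow> (\<forall>z\<in>spectrum UNIV S. z \<noteq> 0 \<longrightarrow> Drazin_invertible UNIV (shift S z))"
  proof (intro iffI ballI impI)
    fix z assume "\<forall>l\<in>spectrum D T. Drazin_invertible D (shift T l)" "z \<in> spectrum UNIV S" "z \<noteq> 0"
    then show "Drazin_invertible UNIV (shift S z)"
      using spectrum_iff[of "l0 + 1 / z"] Drazin_invertible_iff[of "l0 + 1 / z"] by simp
  next
    fix l assume *: "\<forall>z\<in>spectrum UNIV S. z \<noteq> 0 \<longrightarrow> Drazin_invertible UNIV (shift S z)"
      "l \<in> spectrum D T"
    then have "l \<noteq> l0" using l0 by (auto simp: spectrum_def)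
    then show "Drazin_invertible D (shift T l)"
      using * spectrum_iff Drazin_invertible_iff by simp
  qed
  also have "\<dots> \<longleftrightarrow> meromorphic_operator S"
    by (simp add: meromorphic_operator_iff_Drazin[OF S])
  finally show ?thesis .
qed

theorem theorem2p1:
  fixes D :: "'a::complex_banach set" and T :: "'a \<Rightarrow> 'a"
  assumes "closed_linear_operator D T"
    and "resolvent_set D T \<noteq> {}"
  shows "purely_B_discrete_spectrum D T \<longleftrightarrow> has_meromorphic_resolvent D T"
proof -
  have "purely_B_discrete_spectrum D T \<longleftrightarrow> meromorphic_operator (resolvent D T l)"
    if "l \<in> resolvent_set D T" for l
  proof -
    interpret resolvent_at D T l
      using assms(1) that by unfold_locales (auto simp: closed_linear_operator_def)
    show ?thesis using purely_B_discrete_iff_meromorphic by (simp add: S_def)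
  qed
  then show ?thesis using assms(2) by (auto simp: has_meromorphic_resolvent_def)
qed

end
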